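(* Let $X$ be a mixed graph whose underlying graph $\Gamma(X)$ is bipartite and has a unique perfect matching, let $\alpha$ be a complex number with $|\alpha|=1$, and let $H_\alpha$ be the $\alpha$-hermitian adjacency matrix of $X$. Then $H_\alpha$ is nonsingular.
   Context: A mixed graph $X$ consists of a finite vertex set $V(X)$, a set $E_0(X)$ of undirected edges (digons) and a set $E_1(X)$ of directed edges (arcs), with no loops and at most one digon or arc between any two distinct vertices. Its underlying graph $\Gamma(X)$ is obtained by forgetting the orientations of the arcs; a perfect matching of $X$ means a perfect matching of $\Gamma(X)$. For a complex number $\alpha$ of modulus $1$, the $\alpha$-hermitian adjacency matrix $H_\alpha(X)=[h_{uv}]_{u,v\in V(X)}$ is defined by $h_{uv}=1$ if $uv\in E_0(X)$, $h_{uv}=\alpha$ if $uv\in E_1(X)$ (arc from $u$ to $v$), $h_{uv}=\overline{\alpha}$ if $vu\in E_1(X)$, and $h_{uv}=0$ otherwise. *)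

theory Defs
  imports Complex_Main "Jordan_Normal_Form.Matrix"
begin

text \<open>A digon is the set of its two ends; the arc from \<open>u\<close> to \<open>v\<close> is the pair \<open>(u, v)\<close>.\<close>

record 'v mixed_graph =
  verts :: "'v set"
  digons :: "'v set set"
  arcs :: "('v \<times> 'v) set"

definition mixed_graph :: "'v mixed_graph \<Rightarrow> bool" where
  "mixed_graph X \<longleftrightarrow>
     finite (verts X) \<and>
     digons X \<subseteq> {{u, v} | u v. u \<in> verts X \<and> v \<in> verts X \<and> u \<noteq> v} \<and>
     arcs X \<subseteq> {(u, v). u \<in> verts X \<and> v \<in> verts X \<and> u \<noteq> v} \<and>
     (\<forall>u v. (u, v) \<in> arcs X \<longrightarrow> (v, u) \<notin> arcs X \<and> {u, v} \<notin> digons X)"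

definition underlying_edges :: "'v mixed_graph \<Rightarrow> 'v set set" where
  "underlying_edges X = digons X \<union> {{u, v} | u v. (u, v) \<in> arcs X}"

definition bipartite :: "'v set \<Rightarrow> 'v set set \<Rightarrow> bool" where
  "bipartite V E \<longleftrightarrow>
     (\<exists>A B. A \<union> B = V \<and> A \<inter> B = {} \<and> (\<forall>e\<in>E. \<exists>a\<in>A. \<exists>b\<in>B. e = {a, b}))"

definition perfect_matching :: "'v set \<Rightarrow> 'v set set \<Rightarrow> 'v set set \<Rightarrow> bool" where
  "perfect_matching V E M \<longleftrightarrow> M \<subseteq> E \<and> (\<forall>v\<in>V. \<exists>!e. e \<in> M \<and> v \<in> e)"

definition hermitian_entry :: "complex \<Rightarrow> 'v mixed_graph \<Rightarrow> 'v \<Rightarrow> 'v \<Rightarrow> complex" where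
  "hermitian_entry \<alpha> X u v =
     (if {u, v} \<in> digons X then 1
      else if (u, v) \<in> arcs X then \<alpha>
      else if (v, u) \<in> arcs X then cnj \<alpha>
      else 0)"

text \<open>Matrices are indexed by initial segments of the naturals, so the adjacency matrix is taken
  with respect to a list \<open>vs\<close> enumerating the vertices without repetition.\<close>

definition hermitian_adjacency_mat ::
    "complex \<Rightarrow> 'v mixed_graph \<Rightarrow> 'v list \<Rightarrow> complex mat" where
  "hermitian_adjacency_mat \<alpha> X vs =
     mat (length vs) (length vs) (\<lambda>(i, j). hermitian_entry \<alpha> X (vs ! i) (vs ! j))"

end

theory Submission
  imports Defs "Jordan_Normal_Form.Determinant"
begin

text \<open>In the Leibniz expansion of the determinant, a permutation \<open>p\<close> contributes a nonzero term
  iff every \<open>{v, p v}\<close> is an edge. For such a \<open>p\<close> and a bipartition \<open>A, B\<close>, the edges \<open>{a, p a}\<close>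
  with \<open>a \<in> A\<close> form a perfect matching, and so do the edges \<open>{b, p b}\<close> with \<open>b \<in> B\<close>. If the perfect
  matching is unique, \<open>p\<close> is therefore the involution that exchanges matched vertices, so exactly
  one term of the expansion is nonzero.\<close>

text \<open>Every edge crosses between the sides, so \<open>g\<close> injects \<open>A\<close> into
  \<open>B\<close> and \<open>B\<close> into \<open>A\<close>. The sides therefore have equal size
  and \<open>g\<close> maps \<open>A\<close> onto \<open>B\<close>, which makes the edges
  \<open>{a, g a}\<close> disjoint and covering.\<close>

lemma perfect_matching_of_bij:
  assumes fin: "finite A" "finite B" and disj: "A \<inter> B = {}"
    and bip: "\<forall>e\<in>E. \<exists>a\<in>A. \<exists>b\<in>B. e = {a, b}"
    and inj: "inj_on g (A \<union> B)"
    and edge: "\<And>v. v \<in> A \<union> B \<Longrightarrow> {v, g v} \<in> E"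
  shows "perfect_matching (A \<union> B) E ((\<lambda>a. {a, g a}) ` A)"
proof -
  have gA: "g a \<in> B" if "a \<in> A" for a
  proof -
    obtain a' b where "a' \<in> A" "b \<in> B" "{a, g a} = {a', b}"
      using bip edge \<open>a \<in> A\<close> by (metis UnI1)
    with \<open>a \<in> A\<close> disj show ?thesis by (auto simp: doubleton_eq_iff)
  qed
  have gB: "g b \<in> A" if "b \<in> B" for b
  proof -
    obtain a b' where "a \<in> A" "b' \<in> B" "{b, g b} = {a, b'}"
      using bip edge \<open>b \<in> B\<close> by (metis UnI2)
    with \<open>b \<in> B\<close> disj show ?thesis by (auto simp: doubleton_eq_iff)
  qed
  have injA: "inj_on g A" and injB: "inj_on g B"
    using inj by (auto intro: inj_on_subset)
  \<comment> \<open>Injectivity of \<open>g\<close> on \<open>B\<close> serves to bound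
    \<open>card B\<close>; an injection of \<open>A\<close> into the finite set \<open>B\<close> is
    then onto.\<close>
  have "card B \<le> card A"
    using gB by (intro card_inj_on_le[OF injB _ fin(1)]) auto
  then have img: "g ` A = B"
    using gA by (intro card_seteq fin) (auto simp: card_image[OF injA])
  show ?thesis
    unfolding perfect_matching_def
  proof (intro conjI ballI)
    show "(\<lambda>a. {a, g a}) ` A \<subseteq> E"
      using edge by auto
    fix v assume "v \<in> A \<union> B"
    then obtain a where a: "a \<in> A" "v = a \<or> v = g a"
      using img by auto
    show "\<exists>!e. e \<in> (\<lambda>a. {a, g a}) ` A \<and> v \<in> e"
    proof (intro ex1I[of _ "{a, g a}"])
      fix e assume "e \<in> (\<lambda>a. {a, g a}) ` A \<and> v \<in> e"
      then obtain a' where a': "a' \<in> A" "e = {a', g a'}" "v = a' \<or> v = g a'"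
        by blast
      \<comment> \<open>The mixed cases \<open>a = g a'\<close> and \<open>g a = a'\<close> would
        put a vertex on both sides; \<open>g a = g a'\<close> is settled by injectivity.\<close>
      then have "a' = a"
        using a gA[of a] gA[of a'] disj inj_on_eq_iff[OF injA] by blast
      with a' show "e = {a, g a}" by simp
    qed (use a in auto)
  qed
qed

text \<open>Uniqueness identifies \<open>M\<close> both with the edges \<open>{a, g a}\<close>
  leaving \<open>A\<close> and with the edges \<open>{b, g b}\<close> leaving \<open>B\<close>, and
  \<open>v\<close> lies on one of the two sides.\<close>

lemma bij_edges_in_unique_matching:
  assumes fin: "finite V" and bip: "bipartite V E"
    and uniq: "\<exists>!M. perfect_matching V E M" and M: "perfect_matching V E M"
    and inj: "inj_on g V" and edge: "\<And>v. v \<in> V \<Longrightarrow> {v, g v} \<in> E"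
    and "v \<in> V"
  shows "{v, g v} \<in> M"
proof -
  obtain A B where AB: "A \<union> B = V" "A \<inter> B = {}" "\<forall>e\<in>E. \<exists>a\<in>A. \<exists>b\<in>B. e = {a, b}"
    using bip unfolding bipartite_def by blast
  have BA: "B \<union> A = V" "B \<inter> A = {}" "\<forall>e\<in>E. \<exists>b\<in>B. \<exists>a\<in>A. e = {b, a}"
    using AB by (auto simp: insert_commute) (metis insert_commute)
  have fAB: "finite A" "finite B"
    using fin AB(1) by auto
  have "perfect_matching V E ((\<lambda>a. {a, g a}) ` A)"
    using perfect_matching_of_bij[OF fAB AB(2,3)] inj edge AB(1) by simp
  moreover have "perfect_matching V E ((\<lambda>b. {b, g b}) ` B)"
    using perfect_matching_of_bij[OF fAB(2,1) BA(2,3)] inj edge BA(1) by simp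
  ultimately have "M = (\<lambda>a. {a, g a}) ` A" "M = (\<lambda>b. {b, g b}) ` B"
    using uniq M by auto
  with \<open>v \<in> V\<close> AB(1) show ?thesis by blast
qed

text \<open>Sending each vertex to its partner in \<open>M\<close> is an involution of
  \<open>V\<close>, hence a bijection. It supplies a nonzero term of the Leibniz expansion.\<close>

lemma perfect_matching_mate:
  assumes "bipartite V E" and M: "perfect_matching V E M"
  obtains m where "bij_betw m V V" and "\<And>v. v \<in> V \<Longrightarrow> {v, m v} \<in> E"
proof -
  have edges: "\<exists>a\<in>V. \<exists>b\<in>V. a \<noteq> b \<and> e = {a, b}" if "e \<in> M" for e
  proof -
    have "e \<in> E" using M that unfolding perfect_matching_def by auto
    then show ?thesis using assms(1) unfolding bipartite_def by (metis UnCI disjoint_iff)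
  qed
  have cover: "\<exists>!e. e \<in> M \<and> v \<in> e" if "v \<in> V" for v
    using M that unfolding perfect_matching_def by auto
  have "\<exists>w. {v, w} \<in> M" if v: "v \<in> V" for v
  proof -
    obtain e where e: "e \<in> M" "v \<in> e" using cover[OF v] by blast
    with edges[of e] obtain a b where "e = {a, b}" by blast
    with e show ?thesis by (auto simp: insert_commute)
  qed
  then obtain m where m: "\<And>v. v \<in> V \<Longrightarrow> {v, m v} \<in> M" by metis
  have mV: "m v \<in> V" if "v \<in> V" for v
    using edges[OF m[OF that]] by (auto simp: doubleton_eq_iff)
  \<comment> \<open>Both \<open>{v, m v}\<close> and \<open>{m v, m (m v)}\<close> are matching
    edges at \<open>m v\<close>, so they coincide.\<close>
  have mm: "m (m v) = v" if "v \<in> V" for v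
  proof -
    have "{v, m v} = {m v, m (m v)}"
      using cover[OF mV[OF that]] m[OF that] m[OF mV[OF that]] by blast
    then show ?thesis by (auto simp: doubleton_eq_iff)
  qed
  show thesis
  proof
    show "bij_betw m V V"
      by (rule bij_betw_byWitness[where f' = m]) (use mV mm in auto)
    show "{v, m v} \<in> E" if "v \<in> V" for v
      using M m[OF that] unfolding perfect_matching_def by auto
  qed
qed

lemma hermitian_entry_nonzero_iff:
  assumes "\<alpha> \<noteq> 0"
  shows "hermitian_entry \<alpha> X u v \<noteq> 0 \<longleftrightarrow> {u, v} \<in> underlying_edges X"
proof -
  have "{u, v} \<in> underlying_edges X \<longleftrightarrow> {u, v} \<in> digons X \<or> (u, v) \<in> arcs X \<or> (v, u) \<in> arcs X"
    unfolding underlying_edges_def by (fastforce simp: doubleton_eq_iff)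
  then show ?thesis
    using assms by (simp add: hermitian_entry_def)
qed

text \<open>With a single surviving Leibniz term nothing can cancel, and that term is, up to sign, a
  product of nonzero elements of an integral domain.\<close>

lemma det_nonzero_unique_permutation:
  fixes A :: "'a :: idom mat"
  assumes A: "A \<in> carrier_mat n n" and p: "p permutes {0..<n}"
    and nz: "\<And>i. i < n \<Longrightarrow> A $$ (i, p i) \<noteq> 0"
    and uniq: "\<And>q. q permutes {0..<n} \<Longrightarrow> (\<And>i. i < n \<Longrightarrow> A $$ (i, q i) \<noteq> 0) \<Longrightarrow> q = p"
  shows "det A \<noteq> 0"
proof -
  let ?t = "\<lambda>q. signof q * (\<Prod>i = 0..<n. A $$ (i, q i))"
  have zero: "?t q = 0" if "q permutes {0..<n}" "q \<noteq> p" for q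
    using uniq[OF that(1)] that(2) by auto
  have "det A = (\<Sum>q | q permutes {0..<n}. ?t q)"
    using det_def'[OF A] .
  also have "\<dots> = (\<Sum>q \<in> {p}. ?t q)"
    by (rule sum.mono_neutral_right) (simp_all add: finite_permutations p zero)
  finally have "det A = ?t p" by simp
  moreover have "(\<Prod>i = 0..<n. A $$ (i, p i)) \<noteq> 0" using nz by simp
  ultimately show ?thesis by (simp add: sign_def)
qed

lemma invertible_mat_det_nonzero:
  fixes A :: "'a :: field mat"
  assumes A: "A \<in> carrier_mat n n" and "det A \<noteq> 0"
  shows "invertible_mat A"
proof -
  have "A \<in> Units (ring_mat TYPE('a) n ())"
    using det_non_zero_imp_unit[OF assms] .
  then obtain B where "B \<in> carrier_mat n n" "B * A = 1\<^sub>m n" "A * B = 1\<^sub>m n"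
    by (auto simp: Units_def ring_mat_simps)
  with A show ?thesis
    by (auto simp: invertible_mat_def inverts_mat_def)
qed

theorem theorem3:
  fixes X :: "'v mixed_graph" and \<alpha> :: complex and vs :: "'v list"
  assumes "mixed_graph X"
    and "bipartite (verts X) (underlying_edges X)"
    and "\<exists>!M. perfect_matching (verts X) (underlying_edges X) M"
    and "cmod \<alpha> = 1"
    and "distinct vs" and "set vs = verts X"
  shows "invertible_mat (hermitian_adjacency_mat \<alpha> X vs)"
proof -
  let ?V = "verts X" and ?E = "underlying_edges X" and ?n = "length vs"
  let ?H = "hermitian_adjacency_mat \<alpha> X vs"
  \<comment> \<open>\<open>idx\<close> gives the position of a vertex in \<open>vs\<close>; it
    converts between permutations of indices and bijections of vertices.\<close>
  define idx where "idx = inv_into {0..<?n} ((!) vs)"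
  obtain M where M: "perfect_matching ?V ?E M" using assms(3) by blast
  have fin: "finite ?V" using assms(6) by (metis List.finite_set)
  have nth: "bij_betw ((!) vs) {0..<?n} ?V"
    using bij_betw_nth[OF assms(5)] assms(6) by (simp add: atLeast0LessThan)
  have idx: "bij_betw idx ?V {0..<?n}"
    unfolding idx_def using nth by (rule bij_betw_inv_into)
  have idx_nth: "idx (vs ! i) = i" if "i < ?n" for i
    unfolding idx_def using bij_betw_inv_into_left[OF nth] that by simp
  have nth_idx: "vs ! idx v = v" if "v \<in> ?V" for v
    unfolding idx_def using bij_betw_inv_into_right[OF nth that] .
  have H: "?H \<in> carrier_mat ?n ?n"
    by (simp add: hermitian_adjacency_mat_def)
  have "\<alpha> \<noteq> 0" using assms(4) by auto
  then have entry: "?H $$ (i, j) \<noteq> 0 \<longleftrightarrow> {vs ! i, vs ! j} \<in> ?E" if "i < ?n" "j < ?n" for i j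
    using that by (simp add: hermitian_adjacency_mat_def hermitian_entry_nonzero_iff)
  \<comment> \<open>Conjugating \<open>q\<close> by the enumeration gives a bijection
    \<open>?g\<close> of the vertices that moves every vertex along an edge, so the uniqueness of
    \<open>M\<close> applies to it.\<close>
  have matched: "{vs ! i, vs ! q i} \<in> M"
    if q: "q permutes {0..<?n}" and nz: "\<And>i. i < ?n \<Longrightarrow> ?H $$ (i, q i) \<noteq> 0" and i: "i < ?n" for q i
  proof -
    let ?g = "(!) vs \<circ> q \<circ> idx"
    have q_less: "q i < ?n" if "i < ?n" for i
      using permutes_in_image[OF q] that by simp
    have "bij_betw ?g ?V ?V"
      using idx permutes_imp_bij[OF q] nth by (metis bij_betw_trans comp_assoc)
    moreover have "{v, ?g v} \<in> ?E" if "v \<in> ?V" for v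
    proof -
      have "idx v < ?n" using bij_betwE[OF idx] that by simp
      then show ?thesis
        using nz entry q_less nth_idx[OF that] by (metis comp_apply)
    qed
    ultimately have "{vs ! i, ?g (vs ! i)} \<in> M"
      using bij_edges_in_unique_matching[OF fin assms(2,3) M] i assms(6)
      by (metis bij_betw_imp_inj_on nth_mem)
    then show ?thesis using idx_nth i by simp
  qed
  obtain m where m: "bij_betw m ?V ?V" "\<And>v. v \<in> ?V \<Longrightarrow> {v, m v} \<in> ?E"
    using perfect_matching_mate[OF assms(2) M] by blast
  \<comment> \<open>The partner map is carried over to indices; \<open>p\<close> fixes everything
    from \<open>?n\<close> on, as \<open>permutes\<close> demands.\<close>
  define p where "p i = (if i < ?n then idx (m (vs ! i)) else i)" for i
  have "bij_betw (idx \<circ> m \<circ> (!) vs) {0..<?n} {0..<?n}"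
    using nth m(1) idx by (metis bij_betw_trans comp_assoc)
  then have "bij_betw p {0..<?n} {0..<?n}"
    by (rule bij_betw_cong[THEN iffD1, rotated]) (simp add: p_def)
  then have p: "p permutes {0..<?n}"
    by (rule bij_imp_permutes) (simp add: p_def)
  have p_nz: "?H $$ (i, p i) \<noteq> 0" if "i < ?n" for i
  proof -
    have "vs ! i \<in> ?V" using that assms(6) nth_mem by blast
    then have "{vs ! i, vs ! p i} \<in> ?E"
      using m nth_idx bij_betwE that by (metis p_def)
    then show ?thesis
      using entry that permutes_in_image[OF p, of i] by simp
  qed
  have "q = p" if q: "q permutes {0..<?n}" and q_nz: "\<And>i. i < ?n \<Longrightarrow> ?H $$ (i, q i) \<noteq> 0" for q
  proof
    fix i
    show "q i = p i"
    proof (cases "i < ?n")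
      case True
      then have "vs ! i \<in> ?V" using assms(6) nth_mem by blast
      \<comment> \<open>Both sets are edges of \<open>M\<close> at the vertex \<open>vs ! i\<close>,
        and \<open>M\<close> has only one such edge.\<close>
      then have "{vs ! i, vs ! q i} = {vs ! i, vs ! p i}"
        using M matched[OF q q_nz True] matched[OF p p_nz True]
        unfolding perfect_matching_def by blast
      then have "vs ! q i = vs ! p i" by (auto simp: doubleton_eq_iff)
      moreover have "q i < ?n" "p i < ?n"
        using True permutes_in_image[OF p, of i] permutes_in_image[OF q, of i] by auto
      ultimately show ?thesis
        using assms(5) by (simp add: nth_eq_iff_index_eq)
    next
      case False
      then show ?thesis using permutes_not_in[OF p] permutes_not_in[OF q] by simp
    qed
  qed
  then have "det ?H \<noteq> 0"
    using det_nonzero_unique_permutation[OF H p p_nz] by blast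
  then show ?thesis
    using invertible_mat_det_nonzero[OF H] by blast
qed

end
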